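(* Let $q\geq 2$, $\zeta=e^{2\pi i/q}$, $s,t\in\mathbb{Z}_q$ and $g:\mathbb{Z}_q\to\mathbb{C}$. Let $G=(V,E)$ be a finite graph with a fixed orientation $\overrightarrow{E}$ and define $$F^{(q)}(G;\mathbf{x})=\prod_{(u,v)\in\overrightarrow{E}}\;\sum_{b\in\mathbb{Z}_q}g(b)\,x_u^{t-sb}x_v^{b}\ \bmod (x_v^q-1:v\in V).$$ Let $S:\mathbb{Z}_q^V\to\mathbb{Z}_q^E$ be defined by $(S\mathbf{d})_e=d_v-sd_u$ for $e=(u,v)\in\overrightarrow{E}$, with transpose $S^\top$. Then $$\|F^{(q)}(G;\mathbf{x})\|_2^2=\frac{1}{|\mathrm{im}(S)|}\sum_{\mathbf{b}\in\mathrm{im}(S)}\prod_{e\in E}|\widehat{g}(b_e)|^2=\sum_{\mathbf{b}\in\ker(S^\top)}\prod_{e\in E}(g\star g)(b_e).$$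
   Context: For $F\in\mathbb{C}[\mathbf{x}]/(x_v^q-1:v\in V)$ written in the monomial basis $\mathbf{x}^{\mathbf{a}}=\prod_v x_v^{a_v}$, $\mathbf{a}\in\{0,\ldots,q-1\}^V$, the squared $\ell_2$-norm is $\|F\|_2^2=\sum_{\mathbf{a}}|[\mathbf{x}^{\mathbf{a}}]F|^2$. Explicitly $(S^\top\mathbf{b})_v=\sum_{e=(u,v)\in\overrightarrow{E}}b_e-s\sum_{e=(v,u)\in\overrightarrow{E}}b_e$. The Fourier transform is $\widehat{g}(b)=\sum_{a\in\mathbb{Z}_q}g(a)\zeta^{-ab}$, and the cross-correlation is $(g\star g)(a)=\sum_{b\in\mathbb{Z}_q}\overline{g(b)}\,g(b+a)$. *)

theory Defs
  imports
    Complex_Main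
    "HOL-Library.FuncSet"
    "HOL-Library.Poly_Mapping"
    "Berlekamp_Zassenhaus.Finite_Field"
    "Graph_Theory.Digraph"
begin

section \<open>Residues\<close>

text \<open>
  The ring of residues modulo \<open>q \<ge> 2\<close> is \<^typ>\<open>'q mod_ring\<close> for a type \<open>'q\<close> of class
  \<open>nontriv\<close>, with \<open>q = CARD('q)\<close>.
\<close>

definition residue_rep :: "'q::nontriv mod_ring \<Rightarrow> nat" where
  "residue_rep a = nat (to_int_mod_ring a)"

definition zeta :: "nat \<Rightarrow> complex" where
  "zeta q = exp (2 * of_real pi * \<i> / of_nat q)"

definition fourier :: "('q::nontriv mod_ring \<Rightarrow> complex) \<Rightarrow> 'q mod_ring \<Rightarrow> complex" where
  "fourier g b = (\<Sum>a\<in>UNIV. g a * zeta CARD('q) powi (- int (residue_rep a * residue_rep b)))"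

definition cross_correlation ::
  "('q::nontriv mod_ring \<Rightarrow> complex) \<Rightarrow> ('q mod_ring \<Rightarrow> complex) \<Rightarrow> 'q mod_ring \<Rightarrow> complex" where
  "cross_correlation g h a = (\<Sum>b\<in>UNIV. cnj (g b) * h (b + a))"


section \<open>Polynomials modulo \<open>x\<^sub>v\<^sup>q - 1\<close>\<close>

text \<open>
  Multivariate polynomials are finitely supported maps from exponent vectors to coefficients,
  with the convolution product of \<open>Poly_Mapping\<close>.
\<close>

type_synonym 'v cpoly = "('v \<Rightarrow>\<^sub>0 nat) \<Rightarrow>\<^sub>0 complex"

definition pconst :: "complex \<Rightarrow> 'v cpoly" where
  "pconst c = Poly_Mapping.single 0 c"

definition pvar :: "'v \<Rightarrow> 'v cpoly" where
  "pvar v = Poly_Mapping.single (Poly_Mapping.single v 1) 1"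

definition pcoeff :: "'v set \<Rightarrow> 'v cpoly \<Rightarrow> ('v \<Rightarrow> nat) \<Rightarrow> complex" where
  "pcoeff V p a = Poly_Mapping.lookup p (\<Sum>v\<in>V. Poly_Mapping.single v (a v))"

text \<open>The ideal is the span of its generators in the ring regarded as a module over itself.\<close>

definition cyclic_ideal :: "nat \<Rightarrow> 'v set \<Rightarrow> 'v cpoly set" where
  "cyclic_ideal q V = Modules.module.span (*) ((\<lambda>v. pvar v ^ q - 1) ` V)"

definition reduced :: "nat \<Rightarrow> 'v set \<Rightarrow> 'v cpoly \<Rightarrow> bool" where
  "reduced q V p \<longleftrightarrow> (\<forall>m \<in> Poly_Mapping.keys p.
     Poly_Mapping.keys m \<subseteq> V \<and> (\<forall>v\<in>V. Poly_Mapping.lookup m v < q))"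

text \<open>
  A residue class is represented by its expansion in the monomial basis, that is, by its
  unique member with all exponents below \<open>q\<close>; see \<open>ex1_reduced\<close> below.
\<close>

definition mod_cyclic :: "nat \<Rightarrow> 'v set \<Rightarrow> 'v cpoly \<Rightarrow> 'v cpoly" where
  "mod_cyclic q V p = (THE r. reduced q V r \<and> p - r \<in> cyclic_ideal q V)"

definition l2_norm_sq :: "nat \<Rightarrow> 'v set \<Rightarrow> 'v cpoly \<Rightarrow> real" where
  "l2_norm_sq q V p = (\<Sum>a \<in> V \<rightarrow>\<^sub>E {0..q - 1}. (cmod (pcoeff V p a))\<^sup>2)"


subsection \<open>Existence and uniqueness of reduced representatives\<close>

interpretation ideal_module: Modules.module "(*) :: 'a::comm_ring_1 \<Rightarrow> 'a \<Rightarrow> 'a"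
  by standard (simp_all add: algebra_simps)

definition emod :: "nat \<Rightarrow> ('v \<Rightarrow>\<^sub>0 nat) \<Rightarrow> ('v \<Rightarrow>\<^sub>0 nat)" where
  "emod q m = Poly_Mapping.map (\<lambda>k. k mod q) m"

lemma lookup_emod: "Poly_Mapping.lookup (emod q m) v = Poly_Mapping.lookup m v mod q"
  unfolding emod_def by (simp add: Poly_Mapping.map.rep_eq when_def)

text \<open>Coefficient of a residue class at a residue of exponent vectors.\<close>

definition class_coeff :: "nat \<Rightarrow> ('v \<Rightarrow>\<^sub>0 nat) \<Rightarrow> 'v cpoly \<Rightarrow> complex" where
  "class_coeff q a p = (\<Sum>m | m \<in> Poly_Mapping.keys p \<and> emod q m = a. Poly_Mapping.lookup p m)"

lemma class_coeff_superset:
  assumes "finite A" "Poly_Mapping.keys p \<subseteq> A"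
  shows "class_coeff q a p = (\<Sum>m | m \<in> A \<and> emod q m = a. Poly_Mapping.lookup p m)"
  unfolding class_coeff_def using assms
  by (intro sum.mono_neutral_left) (auto simp: in_keys_iff)

lemma class_coeff_add: "class_coeff q a (p + r) = class_coeff q a p + class_coeff q a r"
proof -
  let ?A = "Poly_Mapping.keys p \<union> Poly_Mapping.keys r"
  have A: "finite ?A" "Poly_Mapping.keys (p + r) \<subseteq> ?A" using keys_add[of p r] by auto
  show ?thesis
    using class_coeff_superset[OF A, of q a] class_coeff_superset[of ?A p q a]
      class_coeff_superset[of ?A r q a]
    by (simp add: lookup_add sum.distrib)
qed

lemma class_coeff_single: "class_coeff q a (Poly_Mapping.single m c) = (if emod q m = a then c else 0)"
  using class_coeff_superset[of "{m}" "Poly_Mapping.single m c" q a]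
  by (simp add: conj_commute Collect_conv_if)

lemma cpoly_induct:
  assumes "P 0" "\<And>m c p. P p \<Longrightarrow> P (Poly_Mapping.single m c + p)"
  shows "P (p :: 'v cpoly)"
proof (induction p rule: Poly_Mapping.update_induct)
  case const show ?case by (rule assms(1))
next
  case (update f a b)
  have "Poly_Mapping.update a b f = Poly_Mapping.single a b + f"
    using update(1) by (intro poly_mapping_eqI)
      (auto simp: lookup_update lookup_add lookup_single in_keys_iff when_def)
  then show ?case using assms(2)[OF update(3)] by simp
qed

lemma pvar_power: "pvar v ^ k = Poly_Mapping.single (Poly_Mapping.single v k) 1"
  by (induction k) (simp_all add: pvar_def mult_single single_add[symmetric])

lemma class_coeff_generator: "class_coeff q a (p * (pvar v ^ q - 1)) = 0"
proof (induction p rule: cpoly_induct)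
  case 1 show ?case by (simp add: class_coeff_def)
next
  case (2 m c p)
  have e: "emod q (m + Poly_Mapping.single v q) = emod q m"
    by (rule poly_mapping_eqI) (auto simp: lookup_emod lookup_add lookup_single when_def)
  have "Poly_Mapping.single m c * (pvar v ^ q - 1) =
    Poly_Mapping.single (m + Poly_Mapping.single v q) c + Poly_Mapping.single m (-c)"
    by (simp add: pvar_power right_diff_distrib mult_single single_uminus)
  then show ?case using 2 by (simp add: distrib_right class_coeff_add class_coeff_single e)
qed

lemma class_coeff_ideal: "p \<in> cyclic_ideal q V \<Longrightarrow> class_coeff q a p = 0"
  unfolding cyclic_ideal_def
proof (induction p rule: ideal_module.span_induct_alt)
  case base show ?case by (simp add: class_coeff_def)
next
  case (step c x y)
  then show ?case by (auto simp: class_coeff_add class_coeff_generator)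
qed

lemma reduced_emod:
  assumes "reduced q V r" "m \<in> Poly_Mapping.keys r"
  shows "emod q m = m"
proof (rule poly_mapping_eqI)
  fix v
  have *: "Poly_Mapping.keys m \<subseteq> V" "\<And>v. v \<in> V \<Longrightarrow> Poly_Mapping.lookup m v < q"
    using assms by (auto simp: reduced_def)
  show "Poly_Mapping.lookup (emod q m) v = Poly_Mapping.lookup m v"
  proof (cases "v \<in> V")
    case True then show ?thesis using *(2) by (simp add: lookup_emod)
  next
    case False
    then have "Poly_Mapping.lookup m v = 0" using *(1) by (auto simp: in_keys_iff)
    then show ?thesis by (simp add: lookup_emod)
  qed
qed

lemma class_coeff_reduced: "reduced q V r \<Longrightarrow> emod q m = m \<Longrightarrow> class_coeff q m r = Poly_Mapping.lookup r m"
proof -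
  assume r: "reduced q V r" and m: "emod q m = m"
  have "{k. k \<in> Poly_Mapping.keys r \<and> emod q k = m} = (if m \<in> Poly_Mapping.keys r then {m} else {})"
    using reduced_emod[OF r] m by auto
  then show ?thesis by (simp add: class_coeff_def in_keys_iff)
qed

lemma reduced_unique:
  assumes "reduced q V r" "reduced q V r'" "p - r \<in> cyclic_ideal q V" "p - r' \<in> cyclic_ideal q V"
  shows "r = r'"
proof (rule poly_mapping_eqI)
  fix m
  have "(p - r') - (p - r) \<in> cyclic_ideal q V"
    using assms(3,4) unfolding cyclic_ideal_def by (rule ideal_module.span_diff[rotated])
  then have I: "r - r' \<in> cyclic_ideal q V" by simp
  have "class_coeff q a r = class_coeff q a r'" for a
    using class_coeff_ideal[OF I, of a] class_coeff_add[of q a "r - r'" r'] by simp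
  then have c: "class_coeff q m r = class_coeff q m r'" .
  show "Poly_Mapping.lookup r m = Poly_Mapping.lookup r' m"
  proof (cases "emod q m = m")
    case True then show ?thesis
      using c class_coeff_reduced[OF assms(1)] class_coeff_reduced[OF assms(2)] by simp
  next
    case False
    then have "m \<notin> Poly_Mapping.keys r" "m \<notin> Poly_Mapping.keys r'"
      using reduced_emod assms(1,2) by blast+
    then show ?thesis by (simp add: in_keys_iff)
  qed
qed

lemma ideal_mult: "p \<in> cyclic_ideal q V \<Longrightarrow> c * p \<in> cyclic_ideal q V"
  unfolding cyclic_ideal_def by (rule ideal_module.span_scale)

lemma power_congruent:
  assumes "v \<in> V"
  shows "pvar v ^ k - pvar v ^ (k mod q) \<in> cyclic_ideal q V"
proof -
  have "(pvar v ^ q) ^ j - 1 \<in> cyclic_ideal q V" for j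
  proof (induction j)
    case 0 show ?case by (simp add: cyclic_ideal_def ideal_module.span_zero)
  next
    case (Suc j)
    have "pvar v ^ q - 1 \<in> cyclic_ideal q V"
      unfolding cyclic_ideal_def using assms by (intro ideal_module.span_base) auto
    then have "(pvar v ^ q) ^ j * (pvar v ^ q - 1) + ((pvar v ^ q) ^ j - 1) \<in> cyclic_ideal q V"
      using Suc ideal_mult unfolding cyclic_ideal_def by (intro ideal_module.span_add) auto
    then show ?case by (simp add: algebra_simps)
  qed
  from ideal_mult[OF this[of "k div q"], of "pvar v ^ (k mod q)"] show ?thesis
    by (simp add: right_diff_distrib power_mult[symmetric] power_add[symmetric])
qed

lemma single_congruent:
  assumes "Poly_Mapping.keys m \<subseteq> V"
  shows "Poly_Mapping.single m c - Poly_Mapping.single (emod q m) c \<in> cyclic_ideal q V"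
  using assms
proof (induction m rule: Poly_Mapping.update_induct)
  case const
  have "emod q 0 = (0 :: 'a \<Rightarrow>\<^sub>0 nat)" by (rule poly_mapping_eqI) (simp add: lookup_emod)
  then show ?case by (simp add: cyclic_ideal_def ideal_module.span_zero)
next
  case (update m v k)
  have 1: "Poly_Mapping.update v k m = Poly_Mapping.single v k + m"
    using update(1) by (intro poly_mapping_eqI)
      (auto simp: lookup_update lookup_add lookup_single in_keys_iff when_def)
  have 2: "emod q (Poly_Mapping.update v k m) = Poly_Mapping.single v (k mod q) + emod q m"
    using update(1) by (intro poly_mapping_eqI)
      (auto simp: lookup_update lookup_add lookup_single in_keys_iff when_def lookup_emod)
  have V: "v \<in> V" "Poly_Mapping.keys m \<subseteq> V"
    using update(1,2,4) by (auto simp: keys_update)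
  let ?a = "Poly_Mapping.single m c" and ?a' = "Poly_Mapping.single (emod q m) c"
  have "pvar v ^ k * (?a - ?a') + ?a' * (pvar v ^ k - pvar v ^ (k mod q)) \<in> cyclic_ideal q V"
    using ideal_mult[OF update(3)[OF V(2)]] ideal_mult[OF power_congruent[OF V(1)]]
    unfolding cyclic_ideal_def by (rule ideal_module.span_add)
  also have "pvar v ^ k * (?a - ?a') + ?a' * (pvar v ^ k - pvar v ^ (k mod q))
      = pvar v ^ k * ?a - pvar v ^ (k mod q) * ?a'"
    by (simp add: algebra_simps)
  finally show ?case by (simp add: 1 2[unfolded 1] pvar_power mult_single)
qed

lemma reduced_exists:
  assumes "q > 0" "\<And>m. m \<in> Poly_Mapping.keys p \<Longrightarrow> Poly_Mapping.keys m \<subseteq> V"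
  shows "\<exists>r. reduced q V r \<and> p - r \<in> cyclic_ideal q V"
proof (intro exI conjI)
  let ?r = "\<Sum>m\<in>Poly_Mapping.keys p. Poly_Mapping.single (emod q m) (Poly_Mapping.lookup p m)"
  have sub: "Poly_Mapping.keys ?r \<subseteq> emod q ` Poly_Mapping.keys p"
    by (rule order_trans[OF keys_sum]) (auto split: if_splits)
  have keys: "Poly_Mapping.keys (emod q m) \<subseteq> Poly_Mapping.keys m" for m :: "'a \<Rightarrow>\<^sub>0 nat"
    by (auto simp: in_keys_iff lookup_emod intro: ccontr)
  show "reduced q V ?r"
    unfolding reduced_def
  proof
    fix m assume "m \<in> Poly_Mapping.keys ?r"
    then obtain m' where "m' \<in> Poly_Mapping.keys p" "m = emod q m'" using sub by blast
    then show "Poly_Mapping.keys m \<subseteq> V \<and> (\<forall>v\<in>V. Poly_Mapping.lookup m v < q)"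
      using assms(2)[of m'] keys[of m'] assms(1) by (auto simp: lookup_emod)
  qed
  have p: "p = (\<Sum>m\<in>Poly_Mapping.keys p. Poly_Mapping.single m (Poly_Mapping.lookup p m))"
    by (rule poly_mapping_eqI)
       (simp add: lookup_sum lookup_single when_def in_keys_iff)
  have "p - ?r = (\<Sum>m\<in>Poly_Mapping.keys p. Poly_Mapping.single m (Poly_Mapping.lookup p m)
      - Poly_Mapping.single (emod q m) (Poly_Mapping.lookup p m))"
    by (subst p) (simp add: sum_subtractf)
  also have "\<dots> \<in> cyclic_ideal q V"
    using single_congruent[OF assms(2)] unfolding cyclic_ideal_def by (intro ideal_module.span_sum)
  finally show "p - ?r \<in> cyclic_ideal q V" .
qed

lemma ex1_reduced:
  assumes "q > 0" "\<And>m. m \<in> Poly_Mapping.keys p \<Longrightarrow> Poly_Mapping.keys m \<subseteq> V"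
  shows "\<exists>!r. reduced q V r \<and> p - r \<in> cyclic_ideal q V"
  using reduced_exists[OF assms] reduced_unique by blast


section \<open>Oriented graphs\<close>

text \<open>
  Loops and parallel edges are allowed: \<open>ends e\<close> is the set of the one or two endpoints of
  the edge \<open>e\<close>. An orientation is a digraph on the same vertices and edges, in which
  \<open>e = (u, v)\<close> has tail \<open>u\<close> and head \<open>v\<close>.
\<close>

definition finite_graph :: "'v set \<Rightarrow> 'e set \<Rightarrow> ('e \<Rightarrow> 'v set) \<Rightarrow> bool" where
  "finite_graph V E ends \<longleftrightarrow>
     finite V \<and> finite E \<and> (\<forall>e\<in>E. ends e \<subseteq> V \<and> card (ends e) \<in> {1, 2})"

definition orientation :: "('v, 'e) pre_digraph \<Rightarrow> 'v set \<Rightarrow> 'e set \<Rightarrow> ('e \<Rightarrow> 'v set) \<Rightarrow> bool" where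
  "orientation D V E ends \<longleftrightarrow>
     verts D = V \<and> arcs D = E \<and> (\<forall>e\<in>E. ends e = {tail D e, head D e})"

text \<open>
  Exponents in the residue ring are read through least non-negative representatives; modulo
  \<open>x\<^sub>v\<^sup>q - 1\<close> the choice of representatives is immaterial.
\<close>

definition graph_poly ::
  "'q::nontriv mod_ring \<Rightarrow> 'q mod_ring \<Rightarrow> ('q mod_ring \<Rightarrow> complex) \<Rightarrow> ('v, 'e) pre_digraph \<Rightarrow> 'v cpoly" where
  "graph_poly s t g D = mod_cyclic CARD('q) (verts D)
     (\<Prod>e\<in>arcs D. \<Sum>b\<in>UNIV. pconst (g b)
        * pvar (tail D e) ^ residue_rep (t - s * b) * pvar (head D e) ^ residue_rep b)"

text \<open>
  Vectors indexed by vertices or edges are extensional functions, so that the image and the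
  kernel below are finite sets with the right numbers of elements.
\<close>

definition S_map ::
  "'q::nontriv mod_ring \<Rightarrow> ('v, 'e) pre_digraph \<Rightarrow> ('v \<Rightarrow> 'q mod_ring) \<Rightarrow> ('e \<Rightarrow> 'q mod_ring)" where
  "S_map s D d = (\<lambda>e\<in>arcs D. d (head D e) - s * d (tail D e))"

definition S_transpose ::
  "'q::nontriv mod_ring \<Rightarrow> ('v, 'e) pre_digraph \<Rightarrow> ('e \<Rightarrow> 'q mod_ring) \<Rightarrow> ('v \<Rightarrow> 'q mod_ring)" where
  "S_transpose s D b = (\<lambda>v\<in>verts D. (\<Sum>e | e \<in> arcs D \<and> head D e = v. b e)
     - s * (\<Sum>e | e \<in> arcs D \<and> tail D e = v. b e))"

definition im_S :: "'q::nontriv mod_ring \<Rightarrow> ('v, 'e) pre_digraph \<Rightarrow> ('e \<Rightarrow> 'q mod_ring) set" where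
  "im_S s D = S_map s D ` (verts D \<rightarrow>\<^sub>E UNIV)"

definition ker_S_transpose ::
  "'q::nontriv mod_ring \<Rightarrow> ('v, 'e) pre_digraph \<Rightarrow> ('e \<Rightarrow> 'q mod_ring) set" where
  "ker_S_transpose s D = {b \<in> arcs D \<rightarrow>\<^sub>E UNIV. \<forall>v\<in>verts D. S_transpose s D b v = 0}"

end

theory Submission
  imports Defs
begin

text \<open>
  Expanding the product over the edges, the coefficient of \<open>F\<close> at \<open>a\<close> sums \<open>\<Prod>e. g (\<beta> e)\<close> over
  those \<open>\<beta>\<close> with \<open>S\<^sup>T \<beta> = a - t \<cdot> outdeg\<close>. The squared norm therefore runs over pairs \<open>\<beta>, \<beta>'\<close> with
  \<open>\<beta>' - \<beta> \<in> ker S\<^sup>T\<close>, and summing over \<open>\<beta>\<close> for a fixed difference gives the cross-correlations.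
  For the other formula, expand \<open>|g^(b)|\<^sup>2\<close>, with \<open>g^\<close> the Fourier transform of \<open>g\<close>, as the Fourier
  transform of the autocorrelation. The characters \<open>b \<mapsto> \<zeta> ^ (\<alpha> \<cdot> b)\<close> are trivial on \<open>im S\<close> exactly
  when \<open>\<alpha> \<in> ker S\<^sup>T\<close>, because \<open>\<alpha> \<cdot> S d = S\<^sup>T \<alpha> \<cdot> d\<close>, so summing over \<open>im S\<close> leaves only those \<open>\<alpha>\<close>.
\<close>

(* For a ring as a module over itself this reads a * (b * c) = (a * b) * c,
   which as a rewrite rule loops with mult.assoc. *)
declare ideal_module.scale_scale [simp del]

section \<open>The additive character of the residue ring\<close>

definition character :: "'q::nontriv mod_ring \<Rightarrow> complex" where
  "character a = zeta CARD('q) ^ residue_rep a"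

lemma of_nat_residue_rep: "of_nat (residue_rep a) = (a :: 'q::nontriv mod_ring)"
  unfolding residue_rep_def of_nat_of_int_mod_ring by transfer auto

lemma residue_rep_of_nat: "residue_rep (of_nat n :: 'q::nontriv mod_ring) = n mod CARD('q)"
  unfolding residue_rep_def of_nat_of_int_mod_ring
  by transfer (simp only: o_apply nat_mod_as_int of_nat_mod)

lemma of_nat_eq_iff_mod:
  "(of_nat m :: 'q::nontriv mod_ring) = of_nat n \<longleftrightarrow> m mod CARD('q) = n mod CARD('q)"
proof
  assume "m mod CARD('q) = n mod CARD('q)"
  then have "residue_rep (of_nat m :: 'q mod_ring) = residue_rep (of_nat n :: 'q mod_ring)"
    by (simp only: residue_rep_of_nat)
  then show "(of_nat m :: 'q mod_ring) = of_nat n"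
    using of_nat_residue_rep by metis
next
  assume "(of_nat m :: 'q mod_ring) = of_nat n"
  then show "m mod CARD('q) = n mod CARD('q)"
    by (simp only: flip: residue_rep_of_nat)
qed

lemma zeta_power: "zeta n ^ k = cis (2 * pi * real k / real n)"
proof -
  have "zeta n = cis (2 * pi / real n)"
    unfolding zeta_def cis_conv_exp by (rule arg_cong[where f = exp]) simp
  then show ?thesis
    by (simp only: Complex.DeMoivre times_divide_eq_right mult_ac)
qed

text \<open>Since \<open>zeta q\<close> is a \<open>q\<close>-th root of unity, any representative
  of a residue may serve as the exponent; additivity of \<open>character\<close> then comes from
  powers with natural exponents.\<close>

lemma character_of_nat: "character (of_nat n :: 'q::nontriv mod_ring) = zeta CARD('q) ^ n"
proof -
  let ?q = "CARD('q)"
  have "zeta ?q ^ ?q = 1"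
    by (simp add: zeta_power)
  then have "zeta ?q ^ (?q * (n div ?q) + n mod ?q) = zeta ?q ^ (n mod ?q)"
    unfolding power_add power_mult by simp
  then show ?thesis
    by (simp add: character_def residue_rep_of_nat)
qed

lemma character_add: "character (a + b) = character a * character b"
  by (metis character_of_nat of_nat_add of_nat_residue_rep power_add)

lemma character_0 [simp]: "character 0 = 1"
  using character_of_nat[of 0] by simp

lemma character_sum: "finite A \<Longrightarrow> character (\<Sum>a\<in>A. f a) = (\<Prod>a\<in>A. character (f a))"
  by (induction A rule: finite_induct) (simp_all add: character_add)

text \<open>The root of unity is primitive: its powers with exponents below \<open>q\<close> are
  distinct. This faithfulness later turns a nonzero entry of \<open>S_transpose\<close> into a
  nontrivial character of \<open>im_S\<close>.\<close>

lemma character_eq_1_iff: "character a = 1 \<longleftrightarrow> a = (0 :: 'q::nontriv mod_ring)"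
proof
  assume "character a = 1"
  moreover have "residue_rep a < CARD('q)"
    by (metis mod_less_divisor of_nat_residue_rep residue_rep_of_nat zero_less_card_finite)
  moreover have "inj_on (\<lambda>k. cis (2 * pi * real k / real CARD('q))) {..<CARD('q)}"
    using bij_betw_roots_unity[of "CARD('q)"] by (simp add: bij_betw_def)
  ultimately have "residue_rep a = 0"
    using inj_onD[of "\<lambda>k. cis (2 * pi * real k / real CARD('q))" "{..<CARD('q)}" "residue_rep a" 0]
    by (simp add: character_def zeta_power)
  then show "a = 0"
    by (metis of_nat_0 of_nat_residue_rep)
qed simp

lemma cnj_character_mult_character: "cnj (character a) * character a = 1"
  by (simp add: character_def zeta_power cis_cnj cis_mult)

section \<open>The Fourier transform and the autocorrelation\<close>

lemma fourier_conv_character: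
  "fourier g b = (\<Sum>a\<in>UNIV. g a * cnj (character (a * b)))"
  for g :: "'q::nontriv mod_ring \<Rightarrow> complex"
proof -
  have "zeta CARD('q) powi (- int (residue_rep a * residue_rep b)) = cnj (character (a * b))" for a b :: "'q mod_ring"
  proof -
    have "character (a * b) = zeta CARD('q) ^ (residue_rep a * residue_rep b)"
      by (metis character_of_nat of_nat_mult of_nat_residue_rep)
    then show ?thesis
      unfolding power_int_minus power_int_of_nat by (simp add: zeta_power cis_cnj)
  qed
  then show ?thesis
    by (simp add: fourier_def)
qed

text \<open>The finite Wiener-Khinchin identity. In the double sum for
  \<open>cnj (fourier g b) * fourier g b\<close> substitute \<open>c = d + a\<close>; the phases in
  \<open>d\<close> cancel because characters have modulus 1, and the lag \<open>a\<close>
  remains.\<close>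

lemma cmod_fourier_sq:
  "complex_of_real ((cmod (fourier g b))\<^sup>2)
    = (\<Sum>a\<in>UNIV. cross_correlation g g a * cnj (character (a * b)))"
proof -
  have "complex_of_real ((cmod (fourier g b))\<^sup>2) = cnj (fourier g b) * fourier g b"
    by (metis complex_norm_square mult.commute)
  also have "\<dots> = (\<Sum>d\<in>UNIV. \<Sum>c\<in>UNIV. (cnj (g d) * character (d * b)) * (g c * cnj (character (c * b))))"
    by (simp add: fourier_conv_character sum_product)
  also have "\<dots> = (\<Sum>d\<in>UNIV. \<Sum>a\<in>UNIV. (cnj (g d) * character (d * b))
      * (g (d + a) * cnj (character ((d + a) * b))))"
  proof (rule sum.cong[OF refl])
    fix d
    show "(\<Sum>c\<in>UNIV. (cnj (g d) * character (d * b)) * (g c * cnj (character (c * b))))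
      = (\<Sum>a\<in>UNIV. (cnj (g d) * character (d * b)) * (g (d + a) * cnj (character ((d + a) * b))))"
      by (rule sum.reindex_bij_witness[of _ "\<lambda>a. d + a" "\<lambda>c. c - d"]) auto
  qed
  also have "\<dots> = (\<Sum>d\<in>UNIV. \<Sum>a\<in>UNIV. cnj (g d) * g (d + a) * cnj (character (a * b)))"
  proof (intro sum.cong refl)
    fix d a
    have "cnj (g d) * character (d * b) * (g (d + a) * cnj (character ((d + a) * b)))
      = cnj (g d) * g (d + a) * cnj (character (a * b)) * (cnj (character (d * b)) * character (d * b))"
      by (simp add: distrib_left distrib_right character_add mult_ac)
    then show "cnj (g d) * character (d * b) * (g (d + a) * cnj (character ((d + a) * b)))
      = cnj (g d) * g (d + a) * cnj (character (a * b))"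
      by (simp add: cnj_character_mult_character)
  qed
  also have "\<dots> = (\<Sum>a\<in>UNIV. cross_correlation g g a * cnj (character (a * b)))"
    unfolding cross_correlation_def sum_distrib_right by (rule sum.swap)
  finally show ?thesis .
qed


section \<open>The map \<open>S\<close> and its transpose\<close>

lemma S_transpose_diff:
  "S_transpose s D (\<lambda>e\<in>arcs D. b e - b' e) v = S_transpose s D b v - S_transpose s D b' v"
  if "v \<in> verts D"
  using that by (simp add: S_transpose_def sum_subtractf right_diff_distrib)

lemma S_transpose_adjoint:
  fixes D :: "('v, 'e) pre_digraph"
  assumes "fin_digraph D"
  shows "(\<Sum>e\<in>arcs D. b e * S_map s D d e) = (\<Sum>v\<in>verts D. S_transpose s D b v * d v)"
proof -
  interpret fin_digraph D by fact
  \<comment> \<open>Needed for \<open>head D\<close> and \<open>tail D\<close>: every endpoint is a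
    vertex, so the fibres of \<open>f\<close> over the vertices partition the edges.\<close>
  have *: "(\<Sum>v\<in>verts D. (\<Sum>e | e \<in> arcs D \<and> f e = v. b e) * d v) = (\<Sum>e\<in>arcs D. b e * d (f e))"
    if f: "f ` arcs D \<subseteq> verts D" for f :: "'e \<Rightarrow> 'v"
  proof -
    have "(\<Sum>v\<in>verts D. (\<Sum>e | e \<in> arcs D \<and> f e = v. b e) * d v)
        = (\<Sum>v\<in>verts D. \<Sum>e | e \<in> arcs D \<and> f e = v. b e * d (f e))"
      by (auto simp: sum_distrib_right intro!: sum.cong)
    also have "\<dots> = (\<Sum>e\<in>arcs D. b e * d (f e))"
      using f by (intro sum.group) auto
    finally show ?thesis .
  qed
  have "(\<Sum>v\<in>verts D. S_transpose s D b v * d v)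
    = (\<Sum>v\<in>verts D. (\<Sum>e | e \<in> arcs D \<and> head D e = v. b e) * d v)
      - s * (\<Sum>v\<in>verts D. (\<Sum>e | e \<in> arcs D \<and> tail D e = v. b e) * d v)"
    by (simp add: S_transpose_def left_diff_distrib sum_subtractf mult.assoc flip: sum_distrib_left)
  also have "\<dots> = (\<Sum>e\<in>arcs D. b e * d (head D e)) - s * (\<Sum>e\<in>arcs D. b e * d (tail D e))"
    by (simp add: * image_subset_iff)
  also have "\<dots> = (\<Sum>e\<in>arcs D. b e * S_map s D d e)"
    by (simp add: S_map_def sum_distrib_left right_diff_distrib sum_subtractf mult.left_commute mult.assoc)
  finally show ?thesis by simp
qed

section \<open>The image of \<open>S\<close> as a finite group, and its characters\<close>

lemma finite_im_S: "fin_digraph D \<Longrightarrow> finite (im_S s D)"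
  unfolding im_S_def by (intro finite_imageI finite_PiE) (simp_all add: fin_digraph.finite_verts)

text \<open>By linearity of \<open>S_map\<close>. Together with \<open>im_S_diff\<close> it makes
  translation by an element of the image a permutation of the image.\<close>

lemma im_S_add:
  assumes "fin_digraph D" "b \<in> im_S s D" "b' \<in> im_S s D"
  shows "(\<lambda>e\<in>arcs D. b e + b' e) \<in> im_S s D"
proof -
  interpret fin_digraph D by fact
  obtain d d' where d: "b = S_map s D d" "b' = S_map s D d'"
    using assms unfolding im_S_def by auto
  have "(\<lambda>e\<in>arcs D. b e + b' e) = S_map s D (\<lambda>v\<in>verts D. d v + d' v)"
    by (auto simp: d S_map_def fun_eq_iff algebra_simps)
  then show ?thesis
    unfolding im_S_def by auto
qed

lemma im_S_diff:
  assumes "fin_digraph D" "b \<in> im_S s D" "b' \<in> im_S s D"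
  shows "(\<lambda>e\<in>arcs D. b e - b' e) \<in> im_S s D"
proof -
  interpret fin_digraph D by fact
  obtain d d' where d: "b = S_map s D d" "b' = S_map s D d'"
    using assms unfolding im_S_def by auto
  have "(\<lambda>e\<in>arcs D. b e - b' e) = S_map s D (\<lambda>v\<in>verts D. d v - d' v)"
    by (auto simp: d S_map_def fun_eq_iff algebra_simps)
  then show ?thesis
    unfolding im_S_def by auto
qed

text \<open>Orthogonality of characters on a finite group. By adjointness the character is trivial
  on the image if \<alpha> is in the kernel; otherwise it differs from 1 at some \<open>b0\<close>,
  and translation by \<open>b0\<close> multiplies the sum by that value, so the sum is 0.\<close>

lemma sum_character_im_S:
  fixes s :: "'q::nontriv mod_ring" and D :: "('v, 'e) pre_digraph"
  assumes "fin_digraph D" and \<alpha>: "\<alpha> \<in> arcs D \<rightarrow>\<^sub>E UNIV"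
  shows "(\<Sum>b\<in>im_S s D. character (\<Sum>e\<in>arcs D. \<alpha> e * b e))
    = (if \<alpha> \<in> ker_S_transpose s D then of_nat (card (im_S s D)) else 0)"
proof -
  interpret fin_digraph D by fact
  let ?\<chi> = "\<lambda>b. character (\<Sum>e\<in>arcs D. \<alpha> e * b e)"
  show ?thesis
  proof (cases "\<alpha> \<in> ker_S_transpose s D")
    case True
    then have "?\<chi> b = 1" if "b \<in> im_S s D" for b
      using that by (auto simp: im_S_def S_transpose_adjoint fin_digraph ker_S_transpose_def)
    then show ?thesis
      using True by simp
  next
    case False
    then obtain v where v: "v \<in> verts D" "S_transpose s D \<alpha> v \<noteq> 0"
      using \<alpha> by (auto simp: ker_S_transpose_def)
    \<comment> \<open>The image of the indicator function of \<open>v\<close>: its pairing with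
      \<alpha> isolates the entry of \<open>S_transpose s D \<alpha>\<close> at
      \<open>v\<close>.\<close>
    define b0 where "b0 = S_map s D (\<lambda>w\<in>verts D. if w = v then 1 else 0)"
    have b0: "b0 \<in> im_S s D"
      unfolding b0_def im_S_def by auto
    have "(\<Sum>e\<in>arcs D. \<alpha> e * b0 e) = (\<Sum>w\<in>verts D. if w = v then S_transpose s D \<alpha> w else 0)"
      unfolding b0_def S_transpose_adjoint[OF fin_digraph] by (intro sum.cong) auto
    also have "\<dots> = S_transpose s D \<alpha> v"
      using v(1) by simp
    finally have "(\<Sum>e\<in>arcs D. \<alpha> e * b0 e) = S_transpose s D \<alpha> v" .
    then have "?\<chi> b0 \<noteq> 1"
      using v by (simp add: character_eq_1_iff)
    moreover have "(\<Sum>b\<in>im_S s D. ?\<chi> b) = (\<Sum>b\<in>im_S s D. ?\<chi> (\<lambda>e\<in>arcs D. b e + b0 e))"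
    proof (rule sum.reindex_bij_witness[of _ "\<lambda>b. \<lambda>e\<in>arcs D. b e + b0 e" "\<lambda>b. \<lambda>e\<in>arcs D. b e - b0 e"])
      have "im_S s D \<subseteq> extensional (arcs D)"
        by (auto simp: im_S_def S_map_def)
      then show "(\<lambda>e\<in>arcs D. (\<lambda>e\<in>arcs D. b e - b0 e) e + b0 e) = b"
        "(\<lambda>e\<in>arcs D. (\<lambda>e\<in>arcs D. b e + b0 e) e - b0 e) = b" if "b \<in> im_S s D" for b
        using that by (auto simp: extensional_def fun_eq_iff)
    qed (use b0 in \<open>auto intro: im_S_add im_S_diff fin_digraph\<close>)
    moreover have "(\<Sum>b\<in>im_S s D. ?\<chi> (\<lambda>e\<in>arcs D. b e + b0 e)) = (\<Sum>b\<in>im_S s D. ?\<chi> b) * ?\<chi> b0"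
      by (simp add: distrib_left sum.distrib character_add sum_distrib_right)
    ultimately show ?thesis
      using False by simp
  qed
qed

lemma sum_im_S_fourier:
  fixes g :: "'q::nontriv mod_ring \<Rightarrow> complex" and D :: "('v, 'e) pre_digraph"
  assumes "fin_digraph D"
  shows "complex_of_real (\<Sum>b\<in>im_S s D. \<Prod>e\<in>arcs D. (cmod (fourier g (b e)))\<^sup>2)
    = of_nat (card (im_S s D)) * (\<Sum>b\<in>ker_S_transpose s D. \<Prod>e\<in>arcs D. cross_correlation g g (b e))"
proof -
  interpret fin_digraph D by fact
  let ?C = "\<lambda>\<alpha>. \<Prod>e\<in>arcs D. cross_correlation g g (\<alpha> e)"
  let ?A = "arcs D \<rightarrow>\<^sub>E (UNIV :: 'q mod_ring set)"
  have "complex_of_real (\<Sum>b\<in>im_S s D. \<Prod>e\<in>arcs D. (cmod (fourier g (b e)))\<^sup>2)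
      = (\<Sum>b\<in>im_S s D. \<Prod>e\<in>arcs D. \<Sum>a\<in>UNIV. cross_correlation g g a * cnj (character (a * b e)))"
    by (simp only: of_real_sum of_real_prod cmod_fourier_sq)
  \<comment> \<open>Choosing one lag per edge amounts to choosing \<alpha>, and the edge characters
    multiply to the character of the pairing of \<alpha> with \<open>b\<close>.\<close>
  also have "\<dots> = (\<Sum>b\<in>im_S s D. \<Sum>\<alpha>\<in>?A. ?C \<alpha> * cnj (character (\<Sum>e\<in>arcs D. \<alpha> e * b e)))"
    by (simp add: prod_sum_PiE prod.distrib character_sum)
  also have "\<dots> = (\<Sum>\<alpha>\<in>?A. ?C \<alpha> * cnj (\<Sum>b\<in>im_S s D. character (\<Sum>e\<in>arcs D. \<alpha> e * b e)))"
    by (subst sum.swap) (simp add: sum_distrib_left)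
  also have "\<dots> = (\<Sum>\<alpha>\<in>?A. if \<alpha> \<in> ker_S_transpose s D then of_nat (card (im_S s D)) * ?C \<alpha> else 0)"
    by (intro sum.cong refl) (simp add: sum_character_im_S fin_digraph)
  also have "\<dots> = (\<Sum>\<alpha>\<in>?A \<inter> ker_S_transpose s D. of_nat (card (im_S s D)) * ?C \<alpha>)"
    by (subst sum.inter_restrict) (auto intro: finite_PiE)
  also have "?A \<inter> ker_S_transpose s D = ker_S_transpose s D"
    by (auto simp: ker_S_transpose_def)
  finally show ?thesis
    by (simp add: sum_distrib_left)
qed


section \<open>Coefficients of the graph polynomial\<close>

lemma class_coeff_sum: "class_coeff q a (\<Sum>i\<in>I. f i) = (\<Sum>i\<in>I. class_coeff q a (f i))"
  by (induction I rule: infinite_finite_induct)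
    (simp_all add: class_coeff_add, simp_all add: class_coeff_def)

text \<open>\<open>class_coeff\<close> vanishes on the ideal, so it agrees on \<open>p\<close> and
  its reduced representative, where it is an ordinary coefficient. Coefficients can thus be read off
  the unreduced product.\<close>

lemma class_coeff_mod_cyclic:
  assumes "q > 0" "\<And>m. m \<in> Poly_Mapping.keys p \<Longrightarrow> Poly_Mapping.keys m \<subseteq> V"
    and "emod q m = m"
  shows "Poly_Mapping.lookup (mod_cyclic q V p) m = class_coeff q m p"
proof -
  let ?r = "mod_cyclic q V p"
  have r: "reduced q V ?r" "p - ?r \<in> cyclic_ideal q V"
    using theI'[OF ex1_reduced[of q p V]] assms unfolding mod_cyclic_def by blast+
  have "class_coeff q m p = class_coeff q m ?r"
    using class_coeff_ideal[OF r(2), of m] class_coeff_add[of q m "p - ?r" ?r] by simp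
  then show ?thesis
    using class_coeff_reduced[OF r(1) assms(3)] by simp
qed

text \<open>The exponent vector of the monomial that edge \<open>e\<close> contributes under label
  \<open>b\<close>. As a sum of singles it also covers loops, where both exponents fall on one
  vertex.\<close>

definition arc_exponent ::
  "'q::nontriv mod_ring \<Rightarrow> 'q mod_ring \<Rightarrow> ('v, 'e) pre_digraph \<Rightarrow> 'e \<Rightarrow> 'q mod_ring \<Rightarrow> ('v \<Rightarrow>\<^sub>0 nat)" where
  "arc_exponent s t D e b =
    Poly_Mapping.single (tail D e) (residue_rep (t - s * b)) + Poly_Mapping.single (head D e) (residue_rep b)"

lemma prod_single:
  "finite A \<Longrightarrow> (\<Prod>i\<in>A. Poly_Mapping.single (m i) (c i))
    = Poly_Mapping.single (\<Sum>i\<in>A. m i) (\<Prod>i\<in>A. c i :: 'a::comm_semiring_1)"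
  by (induction A rule: finite_induct) (simp_all add: mult_single)

lemma graph_poly_expand:
  fixes g :: "'q::nontriv mod_ring \<Rightarrow> complex" and D :: "('v, 'e) pre_digraph"
  assumes "finite (arcs D)"
  shows "(\<Prod>e\<in>arcs D. \<Sum>b\<in>UNIV. pconst (g b)
        * pvar (tail D e) ^ residue_rep (t - s * b) * pvar (head D e) ^ residue_rep b)
    = (\<Sum>\<beta>\<in>arcs D \<rightarrow>\<^sub>E UNIV. Poly_Mapping.single (\<Sum>e\<in>arcs D. arc_exponent s t D e (\<beta> e)) (\<Prod>e\<in>arcs D. g (\<beta> e)))"
  using assms
  by (simp add: pconst_def pvar_power mult_single arc_exponent_def prod_sum_PiE prod_single)

text \<open>An edge leaving \<open>v\<close> adds \<open>t - s * \<beta> e\<close>, an edge entering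
  it adds \<open>\<beta> e\<close>. The out-degree term is independent of \<beta>, so it cancels
  when two labelings are compared.\<close>

lemma of_nat_exponent:
  fixes D :: "('v, 'e) pre_digraph"
  assumes "fin_digraph D" "v \<in> verts D"
  shows "of_nat (Poly_Mapping.lookup (\<Sum>e\<in>arcs D. arc_exponent s t D e (\<beta> e)) v)
    = S_transpose s D \<beta> v + of_nat (card {e \<in> arcs D. tail D e = v}) * t"
proof -
  interpret fin_digraph D by fact
  have "of_nat (Poly_Mapping.lookup (\<Sum>e\<in>arcs D. arc_exponent s t D e (\<beta> e)) v)
    = (\<Sum>e\<in>arcs D. if tail D e = v then t - s * \<beta> e else 0) + (\<Sum>e\<in>arcs D. if head D e = v then \<beta> e else 0)"
    unfolding lookup_sum of_nat_sum sum.distrib[symmetric]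
    by (intro sum.cong refl)
      (auto simp: arc_exponent_def lookup_add lookup_single when_def of_nat_residue_rep)
  also have "\<dots> = (\<Sum>e | e \<in> arcs D \<and> tail D e = v. t - s * \<beta> e) + (\<Sum>e | e \<in> arcs D \<and> head D e = v. \<beta> e)"
    by (simp add: sum.inter_filter)
  also have "\<dots> = S_transpose s D \<beta> v + of_nat (card {e \<in> arcs D. tail D e = v}) * t"
    using assms(2) by (simp add: S_transpose_def sum_subtractf sum_distrib_left)
  finally show ?thesis .
qed

text \<open>Restricted to the vertices so that it is itself an index of the sum in
  \<open>l2_norm_sq\<close>.\<close>

definition reduced_exponent ::
  "'q::nontriv mod_ring \<Rightarrow> 'q mod_ring \<Rightarrow> ('v, 'e) pre_digraph \<Rightarrow> ('e \<Rightarrow> 'q mod_ring) \<Rightarrow> ('v \<Rightarrow> nat)" where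
  "reduced_exponent s t D \<beta> = (\<lambda>v\<in>verts D.
     Poly_Mapping.lookup (\<Sum>e\<in>arcs D. arc_exponent s t D e (\<beta> e)) v mod CARD('q))"

lemma reduced_exponent_in:
  "reduced_exponent s t D \<beta> \<in> verts D \<rightarrow>\<^sub>E {0..CARD('q) - 1}"
  for s :: "'q::nontriv mod_ring"
  by (auto simp: reduced_exponent_def less_Suc_eq_le[symmetric])

text \<open>The fibres are cosets of the kernel, by linearity of the transpose.\<close>

lemma reduced_exponent_eq_iff:
  assumes "fin_digraph D"
  shows "reduced_exponent s t D \<beta> = reduced_exponent s t D \<beta>'
    \<longleftrightarrow> (\<lambda>e\<in>arcs D. \<beta>' e - \<beta> e) \<in> ker_S_transpose s D"
proof -
  have "reduced_exponent s t D \<beta> = reduced_exponent s t D \<beta>'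
    \<longleftrightarrow> (\<forall>v\<in>verts D. S_transpose s D \<beta> v = S_transpose s D \<beta>' v)"
    by (auto simp: reduced_exponent_def restrict_def fun_eq_iff of_nat_exponent[OF assms]
        simp flip: of_nat_eq_iff_mod split: if_splits)
  then show ?thesis
    by (auto simp: ker_S_transpose_def S_transpose_diff)
qed

lemma pcoeff_graph_poly:
  fixes g :: "'q::nontriv mod_ring \<Rightarrow> complex" and D :: "('v, 'e) pre_digraph"
  assumes "fin_digraph D" and a: "a \<in> verts D \<rightarrow>\<^sub>E {0..CARD('q) - 1}"
  shows "pcoeff (verts D) (graph_poly s t g D) a
    = (\<Sum>\<beta>\<in>arcs D \<rightarrow>\<^sub>E UNIV. if reduced_exponent s t D \<beta> = a then \<Prod>e\<in>arcs D. g (\<beta> e) else 0)"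
proof -
  interpret fin_digraph D by fact
  let ?M = "\<lambda>\<beta>. \<Sum>e\<in>arcs D. arc_exponent s t D e (\<beta> e)"
  let ?m = "\<Sum>v\<in>verts D. Poly_Mapping.single v (a v)"
  let ?P = "\<Sum>\<beta>\<in>arcs D \<rightarrow>\<^sub>E UNIV. Poly_Mapping.single (?M \<beta>) (\<Prod>e\<in>arcs D. g (\<beta> e))"
  have m: "Poly_Mapping.lookup ?m v = (if v \<in> verts D then a v else 0)" for v
    by (simp add: lookup_sum lookup_single when_def)
  \<comment> \<open>The bound \<open>CARD('q) - 1\<close> is a truncated difference; positivity of
    the cardinality makes it strict.\<close>
  have a_less: "a v < CARD('q)" if "v \<in> verts D" for v
    using PiE_mem[OF a that] zero_less_card_finite[where 'a = 'q]
    unfolding atLeastAtMost_iff by linarith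
  have keys_M: "Poly_Mapping.keys (?M \<beta>) \<subseteq> verts D" for \<beta>
    by (rule order_trans[OF keys_sum])
      (auto simp: arc_exponent_def dest!: keys_add[THEN subsetD] split: if_splits)
  have emod_m: "emod CARD('q) ?m = ?m"
    by (rule poly_mapping_eqI) (simp add: lookup_emod m a_less)
  have keys_P: "Poly_Mapping.keys m \<subseteq> verts D" if "m \<in> Poly_Mapping.keys ?P" for m
    using subsetD[OF keys_sum that] keys_M by (auto split: if_splits)
  have emod_iff: "emod CARD('q) (?M \<beta>) = ?m \<longleftrightarrow> reduced_exponent s t D \<beta> = a" for \<beta>
  proof -
    have out: "Poly_Mapping.lookup (?M \<beta>) v = 0" if "v \<notin> verts D" for v
      using keys_M[of \<beta>] that by (meson in_keys_iff subsetD)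
    \<comment> \<open>Off the vertices both exponent vectors are 0, so only the vertices need
      comparing.\<close>
    have "emod CARD('q) (?M \<beta>) = ?m \<longleftrightarrow> (\<forall>v\<in>verts D. Poly_Mapping.lookup (?M \<beta>) v mod CARD('q) = a v)"
      unfolding poly_mapping_eq_iff fun_eq_iff lookup_emod m using out by auto
    also have "\<dots> \<longleftrightarrow> reduced_exponent s t D \<beta> = a"
      using a by (auto simp: reduced_exponent_def fun_eq_iff PiE_def extensional_def restrict_def)
    finally show ?thesis .
  qed
  have "pcoeff (verts D) (graph_poly s t g D) a = class_coeff CARD('q) ?m ?P"
    unfolding pcoeff_def graph_poly_def graph_poly_expand[OF finite_arcs]
    by (intro class_coeff_mod_cyclic keys_P emod_m) simp
  also have "\<dots> = (\<Sum>\<beta>\<in>arcs D \<rightarrow>\<^sub>E UNIV. if reduced_exponent s t D \<beta> = a then \<Prod>e\<in>arcs D. g (\<beta> e) else 0)"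
    by (simp add: class_coeff_sum class_coeff_single emod_iff)
  finally show ?thesis .
qed

section \<open>The squared norm as a sum over pairs of edge labelings\<close>

lemma sum_cmod_sq_fibres:
  assumes "finite A" "finite B" "f ` A \<subseteq> B"
  shows "complex_of_real (\<Sum>b\<in>B. (cmod (\<Sum>x\<in>A. if f x = b then w x else 0))\<^sup>2)
    = (\<Sum>x\<in>A. \<Sum>y\<in>A. if f x = f y then cnj (w x) * w y else 0)"
proof -
  \<comment> \<open>The condition \<open>f x = b\<close> and \<open>f y = b\<close> is nested as
    \<open>f x = b\<close> and \<open>f x = f y\<close>, so that after the swap the sum over
    \<open>b\<close> collapses to the single term \<open>b = f x\<close>.\<close>
  have "complex_of_real (\<Sum>b\<in>B. (cmod (\<Sum>x\<in>A. if f x = b then w x else 0))\<^sup>2)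
    = (\<Sum>b\<in>B. \<Sum>x\<in>A. \<Sum>y\<in>A. if f x = b then (if f x = f y then cnj (w x) * w y else 0) else 0)"
    unfolding of_real_sum
  proof (rule sum.cong[OF refl])
    fix b
    have cmod_sq: "complex_of_real ((cmod z)\<^sup>2) = cnj z * z" for z
      by (metis complex_norm_square mult.commute)
    show "complex_of_real ((cmod (\<Sum>x\<in>A. if f x = b then w x else 0))\<^sup>2)
      = (\<Sum>x\<in>A. \<Sum>y\<in>A. if f x = b then (if f x = f y then cnj (w x) * w y else 0) else 0)"
      unfolding cmod_sq cnj_sum sum_product by (intro sum.cong refl) auto
  qed
  also have "\<dots> = (\<Sum>x\<in>A. \<Sum>y\<in>A. \<Sum>b\<in>B. if f x = b then (if f x = f y then cnj (w x) * w y else 0) else 0)"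
    by (subst sum.swap, intro sum.cong refl, rule sum.swap)
  also have "\<dots> = (\<Sum>x\<in>A. \<Sum>y\<in>A. if f x = f y then cnj (w x) * w y else 0)"
    using assms by (intro sum.cong refl) (auto simp: sum.delta')
  finally show ?thesis .
qed

lemma l2_norm_sq_graph_poly:
  fixes g :: "'q::nontriv mod_ring \<Rightarrow> complex" and D :: "('v, 'e) pre_digraph"
  assumes "fin_digraph D"
  shows "complex_of_real (l2_norm_sq CARD('q) (verts D) (graph_poly s t g D))
    = (\<Sum>b\<in>ker_S_transpose s D. \<Prod>e\<in>arcs D. cross_correlation g g (b e))"
proof -
  interpret fin_digraph D by fact
  let ?A = "arcs D \<rightarrow>\<^sub>E (UNIV :: 'q mod_ring set)"
  let ?G = "\<lambda>\<beta>. \<Prod>e\<in>arcs D. g (\<beta> e)"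
  let ?K = "ker_S_transpose s D"
  have "complex_of_real (l2_norm_sq CARD('q) (verts D) (graph_poly s t g D))
    = complex_of_real (\<Sum>a \<in> verts D \<rightarrow>\<^sub>E {0..CARD('q) - 1}.
        (cmod (\<Sum>\<beta>\<in>?A. if reduced_exponent s t D \<beta> = a then ?G \<beta> else 0))\<^sup>2)"
    by (simp add: l2_norm_sq_def pcoeff_graph_poly fin_digraph cong: sum.cong)
  also have "\<dots> = (\<Sum>\<beta>\<in>?A. \<Sum>\<beta>'\<in>?A. if reduced_exponent s t D \<beta> = reduced_exponent s t D \<beta>'
      then cnj (?G \<beta>) * ?G \<beta>' else 0)"
    by (intro sum_cmod_sq_fibres finite_PiE image_subsetI reduced_exponent_in) simp_all
  also have "\<dots> = (\<Sum>\<beta>\<in>?A. \<Sum>\<delta>\<in>?K. \<Prod>e\<in>arcs D. cnj (g (\<beta> e)) * g (\<beta> e + \<delta> e))"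
  proof (rule sum.cong[OF refl])
    fix \<beta> assume \<beta>: "\<beta> \<in> ?A"
    have "(\<Sum>\<beta>'\<in>?A. if reduced_exponent s t D \<beta> = reduced_exponent s t D \<beta>' then cnj (?G \<beta>) * ?G \<beta>' else 0)
      = (\<Sum>\<beta>' | \<beta>' \<in> ?A \<and> (\<lambda>e\<in>arcs D. \<beta>' e - \<beta> e) \<in> ?K. cnj (?G \<beta>) * ?G \<beta>')"
      unfolding reduced_exponent_eq_iff[OF fin_digraph]
      by (rule sum.inter_filter[symmetric]) (auto intro: finite_PiE)
    \<comment> \<open>Substitute \<beta>' = \<beta> + \<delta> on the edges, with \<delta> running
      over the kernel.\<close>
    also have "\<dots> = (\<Sum>\<delta>\<in>?K. \<Prod>e\<in>arcs D. cnj (g (\<beta> e)) * g (\<beta> e + \<delta> e))"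
    proof (rule sum.reindex_bij_witness[of _ "\<lambda>\<delta>. \<lambda>e\<in>arcs D. \<beta> e + \<delta> e" "\<lambda>\<beta>'. \<lambda>e\<in>arcs D. \<beta>' e - \<beta> e"])
      fix \<delta> assume \<delta>: "\<delta> \<in> ?K"
      then show *: "(\<lambda>e\<in>arcs D. (\<lambda>e\<in>arcs D. \<beta> e + \<delta> e) e - \<beta> e) = \<delta>"
        by (auto simp: ker_S_transpose_def fun_eq_iff PiE_def extensional_def)
      show "(\<lambda>e\<in>arcs D. \<beta> e + \<delta> e) \<in> {\<beta>' \<in> ?A. (\<lambda>e\<in>arcs D. \<beta>' e - \<beta> e) \<in> ?K}"
        using \<delta> * by simp
    next
      fix \<beta>' assume "\<beta>' \<in> {\<beta>' \<in> ?A. (\<lambda>e\<in>arcs D. \<beta>' e - \<beta> e) \<in> ?K}"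
      then show "(\<lambda>e\<in>arcs D. \<beta> e + (\<lambda>e\<in>arcs D. \<beta>' e - \<beta> e) e) = \<beta>'"
        by (auto simp: fun_eq_iff PiE_def extensional_def)
    qed (auto simp: prod.distrib)
    finally show "(\<Sum>\<beta>'\<in>?A. if reduced_exponent s t D \<beta> = reduced_exponent s t D \<beta>'
        then cnj (?G \<beta>) * ?G \<beta>' else 0) = (\<Sum>\<delta>\<in>?K. \<Prod>e\<in>arcs D. cnj (g (\<beta> e)) * g (\<beta> e + \<delta> e))" .
  qed
  also have "\<dots> = (\<Sum>\<delta>\<in>?K. \<Sum>\<beta>\<in>?A. \<Prod>e\<in>arcs D. cnj (g (\<beta> e)) * g (\<beta> e + \<delta> e))"
    by (rule sum.swap)
  \<comment> \<open>For fixed \<delta> the summand is a product of factors each depending on one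
    \<open>\<beta> e\<close>, so the sum over \<beta> factors over the edges.\<close>
  also have "\<dots> = (\<Sum>\<delta>\<in>?K. \<Prod>e\<in>arcs D. cross_correlation g g (\<delta> e))"
    unfolding cross_correlation_def by (simp add: prod_sum_PiE)
  finally show ?thesis .
qed

theorem theorem6:
  fixes s t :: "'q::nontriv mod_ring"
    and g :: "'q mod_ring \<Rightarrow> complex"
    and V :: "'v set" and E :: "'e set" and ends :: "'e \<Rightarrow> 'v set"
    and D :: "('v, 'e) pre_digraph"
  assumes "finite_graph V E ends"
    and "orientation D V E ends"
  shows "l2_norm_sq CARD('q) V (graph_poly s t g D)
           = 1 / real (card (im_S s D)) * (\<Sum>b\<in>im_S s D. \<Prod>e\<in>E. (cmod (fourier g (b e)))\<^sup>2)
       \<and> complex_of_real (l2_norm_sq CARD('q) V (graph_poly s t g D))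
           = (\<Sum>b\<in>ker_S_transpose s D. \<Prod>e\<in>E. cross_correlation g g (b e))"
proof
  have VE: "verts D = V" "arcs D = E"
    using assms(2) by (auto simp: orientation_def)
  have fin: "fin_digraph D"
    using assms by unfold_locales (auto simp: orientation_def finite_graph_def)
  let ?N = "l2_norm_sq CARD('q) V (graph_poly s t g D)"
  show N: "complex_of_real ?N = (\<Sum>b\<in>ker_S_transpose s D. \<Prod>e\<in>E. cross_correlation g g (b e))"
    using l2_norm_sq_graph_poly[OF fin] unfolding VE .
  \<comment> \<open>The kernel sum is a complex expression; both sides here are embedded reals, so
    the identity descends to the reals.\<close>
  have "complex_of_real (\<Sum>b\<in>im_S s D. \<Prod>e\<in>E. (cmod (fourier g (b e)))\<^sup>2)
      = complex_of_real (real (card (im_S s D)) * ?N)"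
    using sum_im_S_fourier[OF fin, of g s] unfolding VE N[symmetric] by simp
  then have "(\<Sum>b\<in>im_S s D. \<Prod>e\<in>E. (cmod (fourier g (b e)))\<^sup>2) = real (card (im_S s D)) * ?N"
    by (rule of_real_eq_iff[THEN iffD1])
  \<comment> \<open>Permits the division; the image is nonempty even for an empty vertex set, which
    still has one extensional function.\<close>
  moreover have "card (im_S s D) > 0"
    using finite_im_S[OF fin] by (auto simp: card_gt_0_iff im_S_def PiE_eq_empty_iff)
  ultimately show "?N = 1 / real (card (im_S s D)) * (\<Sum>b\<in>im_S s D. \<Prod>e\<in>E. (cmod (fourier g (b e)))\<^sup>2)"
    by simp
qed

end
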